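(* Let $\alpha,\beta,\gamma\in[0,1]$ with $\alpha=\gamma$ and $\beta+\gamma>1$. Then there exists a constant $c$ such that, as $n\to\infty$ over even integers, asymptotically almost surely the subgraph $\mathcal{H}$ of the Kronecker graph $\mathcal{K}(n,\mathbf{P})$ induced by the middle layer $U=\{v\in\{0,1\}^n: w(v)=n/2\}$ satisfies $\operatorname{diam}(\mathcal{H})<c$.
   Context: Let $\mathbf{P}$ be the symmetric $2\times 2$ matrix with rows and columns indexed by $1,0$, with $\mathbf{P}[1,1]=\alpha$, $\mathbf{P}[1,0]=\mathbf{P}[0,1]=\beta$, $\mathbf{P}[0,0]=\gamma$. The Kronecker graph $\mathcal{K}(n,\mathbf{P})$ is the random graph with vertex set $\{0,1\}^n$ in which two distinct vertices $u,v$ are adjacent with probability $\prod_{i=1}^n\mathbf{P}[u_i,v_i]$, independently for each pair. The weight $w(v)$ of $v=(v_1,\dots,v_n)$ is $\sum_i v_i$. The diameter is the maximum graph distance between two vertices (infinite if disconnected). Throughout, $n$ is assumed even. *)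

theory Defs
  imports "HOL-Probability.Probability" "HOL-Library.Extended_Nat"
begin

type_synonym 'a graph = "'a set \<times> 'a set set"

definition induced_subgraph :: "'a graph \<Rightarrow> 'a set \<Rightarrow> 'a graph" where
  "induced_subgraph G U = (fst G \<inter> U, {e \<in> snd G. e \<subseteq> U})"

definition is_walk :: "'a graph \<Rightarrow> 'a \<Rightarrow> 'a list \<Rightarrow> 'a \<Rightarrow> bool" where
  "is_walk G u xs v \<longleftrightarrow>
     xs \<noteq> [] \<and> hd xs = u \<and> last xs = v \<and> set xs \<subseteq> fst G \<and>
     successively (\<lambda>x y. {x, y} \<in> snd G) xs"

text \<open>A walk listed by its vertices has one edge fewer than vertices; the infimum over the
  empty set is \<open>\<infinity>\<close>, so vertices in different components have infinite distance.\<close>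
definition graph_dist :: "'a graph \<Rightarrow> 'a \<Rightarrow> 'a \<Rightarrow> enat" where
  "graph_dist G u v = (INF xs \<in> {xs. is_walk G u xs v}. enat (length xs - 1))"

definition diam :: "'a graph \<Rightarrow> enat" where
  "diam G = (SUP u \<in> fst G. SUP v \<in> fst G. graph_dist G u v)"

text \<open>The matrix indices \<open>1\<close> and \<open>0\<close> are encoded as \<^const>\<open>True\<close> and \<^const>\<open>False\<close>, and
  elements of \<open>{0,1}\<^sup>n\<close> as Boolean lists of length \<open>n\<close>.\<close>
fun kron_matrix :: "real \<Rightarrow> real \<Rightarrow> real \<Rightarrow> bool \<Rightarrow> bool \<Rightarrow> real" where
  "kron_matrix \<alpha> \<beta> \<gamma> True True = \<alpha>"
| "kron_matrix \<alpha> \<beta> \<gamma> True False = \<beta>"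
| "kron_matrix \<alpha> \<beta> \<gamma> False True = \<beta>"
| "kron_matrix \<alpha> \<beta> \<gamma> False False = \<gamma>"

definition cube :: "nat \<Rightarrow> bool list set" where
  "cube n = {v. length v = n}"

definition weight :: "bool list \<Rightarrow> nat" where
  "weight v = (\<Sum>b\<leftarrow>v. of_bool b)"

definition middle_layer :: "nat \<Rightarrow> bool list set" where
  "middle_layer n = {v \<in> cube n. weight v = n div 2}"

definition vertex_pairs :: "nat \<Rightarrow> bool list set set" where
  "vertex_pairs n = {{u, v} | u v. u \<in> cube n \<and> v \<in> cube n \<and> u \<noteq> v}"

definition kron_prob :: "nat \<Rightarrow> (bool \<Rightarrow> bool \<Rightarrow> real) \<Rightarrow> bool list \<Rightarrow> bool list \<Rightarrow> real" where
  "kron_prob n P u v = (\<Prod>i<n. P (u ! i) (v ! i))"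

text \<open>For symmetric \<open>P\<close> the value of \<^term>\<open>kron_prob n P u v\<close> does not depend on the order of
  \<open>u\<close> and \<open>v\<close>, so it is a function of the unordered pair \<open>{u, v}\<close>
  (lemma \<open>kron_edge_prob_pair\<close>).\<close>
definition kron_edge_prob :: "nat \<Rightarrow> (bool \<Rightarrow> bool \<Rightarrow> real) \<Rightarrow> bool list set \<Rightarrow> real" where
  "kron_edge_prob n P e = (THE p. \<exists>u v. e = {u, v} \<and> p = kron_prob n P u v)"

definition kronecker_graph :: "nat \<Rightarrow> (bool \<Rightarrow> bool \<Rightarrow> real) \<Rightarrow> bool list graph pmf" where
  "kronecker_graph n P =
     map_pmf (\<lambda>f. (cube n, {e \<in> vertex_pairs n. f e}))
       (Pi_pmf (vertex_pairs n) False (\<lambda>e. bernoulli_pmf (kron_edge_prob n P e)))"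

lemma kron_matrix_sym: "kron_matrix \<alpha> \<beta> \<gamma> a b = kron_matrix \<alpha> \<beta> \<gamma> b a"
  by (cases a; cases b) auto

lemma kron_edge_prob_pair:
  assumes "\<And>a b. P a b = P b a"
  shows "kron_edge_prob n P {u, v} = kron_prob n P u v"
proof -
  have "kron_prob n P u v = kron_prob n P v u"
    unfolding kron_prob_def using assms by (intro prod.cong) auto
  then show ?thesis
    unfolding kron_edge_prob_def by (intro the_equality) (auto simp: doubleton_eq_iff)
qed

lemma finite_vertex_pairs: "finite (vertex_pairs n)"
proof -
  have "finite (cube n)"
    using finite_lists_length_eq[of "UNIV :: bool set" n] by (simp add: cube_def)
  moreover have "vertex_pairs n \<subseteq> Pow (cube n)"
    by (auto simp: vertex_pairs_def)
  ultimately show ?thesis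
    by (meson finite_Pow_iff finite_subset)
qed

lemma prob_edge_kronecker_graph:
  assumes "\<And>a b. P a b = P b a" "\<And>a b. P a b \<in> {0..1}"
    and "u \<in> cube n" "v \<in> cube n" "u \<noteq> v"
  shows "measure_pmf.prob (kronecker_graph n P) {G. {u, v} \<in> snd G} = kron_prob n P u v"
proof -
  define Q where "Q = Pi_pmf (vertex_pairs n) False (\<lambda>e. bernoulli_pmf (kron_edge_prob n P e))"
  have uv: "{u, v} \<in> vertex_pairs n"
    using assms by (auto simp: vertex_pairs_def)
  have p: "kron_prob n P u v \<in> {0..1}"
    unfolding kron_prob_def using assms(2) by (auto intro!: prod_nonneg prod_le_1)
  have "measure_pmf.prob (kronecker_graph n P) {G. {u, v} \<in> snd G} = measure_pmf.prob Q {f. f {u, v}}"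
    using uv by (simp add: kronecker_graph_def Q_def vimage_def)
  also have "\<dots> = measure_pmf.prob (map_pmf (\<lambda>f. f {u, v}) Q) {True}"
    by (simp add: vimage_def)
  also have "map_pmf (\<lambda>f. f {u, v}) Q = bernoulli_pmf (kron_edge_prob n P {u, v})"
    unfolding Q_def using uv by (intro Pi_pmf_component[THEN trans]) (auto simp: finite_vertex_pairs)
  finally show ?thesis
    using p by (simp add: kron_edge_prob_pair[OF assms(1)] measure_pmf_single)
qed

end

theory Submission
  imports Defs "HOL-Computational_Algebra.Polynomial" "HOL-Real_Asymp.Real_Asymp"
begin

text \<open>
  On the cube the edge probabilities form a tensor power of a symmetric two-point kernel whose
  normalised second eigenvalue \<open>r = \<bar>\<beta> - \<gamma>\<bar> / (\<beta> + \<gamma>)\<close> is less than \<open>1\<close>. Two-point inequalities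
  tensorise to hypercontractivity and reverse hypercontractivity: for sets of densities \<open>a, b\<close> the
  expected number of edges between them lies between \<open>(2 (\<beta> + \<gamma>))\<^sup>n\<close> times
  \<open>(a b)\<close> to the power \<open>1 / (1 - r)\<close> and to the power \<open>1 / (1 + r)\<close>.

  A union bound over all pairs \<open>X \<subseteq> S\<close> of sets of vertices shows that, with high probability, the
  expected number of edges from \<open>X\<close> to the complement of its closed neighbourhood \<open>S\<close> is at most
  \<open>2 n \<bar>S\<bar>\<close>. Every vertex has exponentially large expected degree inside the middle layer, so by the
  upper bound every set that is exponentially sparse is enlarged by an exponential factor when
  passing to its neighbourhood. Hence a bounded number of steps from any vertex reaches a set of
  density at least \<open>exp (- \<eta> n)\<close>, and by the lower bound two such sets are adjacent or intersect.
\<close>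

subsection \<open>Two-point inequalities\<close>

text \<open>After taking logarithms, the two sides agree at \<open>a = 0\<close>, and the derivative
  of their difference is nonnegative because \<open>r * x \<le> x\<close>. This decides the sign of
  the derivative in \<open>power_mean_gap\<close>.\<close>

lemma powr_ratio_ge:
  fixes r a :: real
  assumes "0 \<le> r" "r < 1" "0 \<le> a" "a < 1"
  shows "(1 - a) powr r * (1 + r * a) \<le> (1 + a) powr r * (1 - r * a)"
proof -
  define h where "h = (\<lambda>x. (r * ln (1 + x) + ln (1 - r * x)) - (r * ln (1 - x) + ln (1 + r * x)))"
  have pos: "1 - r * x > 0" "1 + r * x > 0" if "0 \<le> x" "x < 1" for x
  proof -
    have "r * x \<le> x" using assms that by (simp add: mult_left_le_one_le)
    then show "1 - r * x > 0" using \<open>x < 1\<close> by linarith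
    show "1 + r * x > 0" using that assms by (simp add: add_pos_nonneg)
  qed
  have "h 0 \<le> h a"
  proof (rule DERIV_nonneg_imp_nondecreasing[where f = h])
    show "0 \<le> a" by fact
    fix x assume x: "0 \<le> x" "x \<le> a"
    then have x1: "x < 1" using assms by simp
    have "(h has_real_derivative
        ((r * (1 / (1 + x)) + (- r) / (1 - r * x)) - (r * ((- 1) / (1 - x)) + r / (1 + r * x)))) (at x)"
      unfolding h_def using x x1 pos[of x] by (auto intro!: derivative_eq_intros)
    moreover have "(r * (1 / (1 + x)) + (- r) / (1 - r * x)) - (r * ((- 1) / (1 - x)) + r / (1 + r * x))
        = 2 * r * (1 / (1 - x\<^sup>2) - 1 / (1 - (r * x)\<^sup>2))"
    proof -
      have 1: "1 - x\<^sup>2 = (1 - x) * (1 + x)" "1 - (r * x)\<^sup>2 = (1 - r * x) * (1 + r * x)"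
        by (simp_all add: algebra_simps power2_eq_square)
      have "1 / (1 + x) + 1 / (1 - x) = 2 / (1 - x\<^sup>2)"
        unfolding 1 using x x1 by (simp add: field_simps)
      moreover have "1 / (1 - r * x) + 1 / (1 + r * x) = 2 / (1 - (r * x)\<^sup>2)"
        unfolding 1 using pos[of x] x x1 by (simp add: add_divide_eq_iff divide_add_eq_iff)
      moreover have "(r * (1 / (1 + x)) + (- r) / (1 - r * x)) - (r * ((- 1) / (1 - x)) + r / (1 + r * x))
          = r * (1 / (1 + x) + 1 / (1 - x)) - r * (1 / (1 - r * x) + 1 / (1 + r * x))"
        by (simp add: distrib_left)
      ultimately show ?thesis by (simp add: right_diff_distrib mult.commute)
    qed
    moreover have "1 / (1 - (r * x)\<^sup>2) \<le> 1 / (1 - x\<^sup>2)"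
    proof (rule divide_left_mono)
      have "r * x \<le> x" using assms x by (simp add: mult_left_le_one_le)
      then have "(r * x)\<^sup>2 \<le> x\<^sup>2" using assms x by (intro power_mono) auto
      then show "1 - x\<^sup>2 \<le> 1 - (r * x)\<^sup>2" by simp
      have "x\<^sup>2 < 1" using x x1 by (simp add: power_less_one_iff)
      then show "0 < (1 - (r * x)\<^sup>2) * (1 - x\<^sup>2)"
        using \<open>(r * x)\<^sup>2 \<le> x\<^sup>2\<close> by simp
    qed simp
    ultimately show "\<exists>y. (h has_real_derivative y) (at x) \<and> 0 \<le> y"
      using assms(1) by (intro exI[of _ "2 * r * (1 / (1 - x\<^sup>2) - 1 / (1 - (r * x)\<^sup>2))"]) simp
  qed
  then have "r * ln (1 - a) + ln (1 + r * a) \<le> r * ln (1 + a) + ln (1 - r * a)"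
    by (simp add: h_def)
  then have "exp (r * ln (1 - a) + ln (1 + r * a)) \<le> exp (r * ln (1 + a) + ln (1 - r * a))"
    by simp
  then show ?thesis
    using assms pos[of a] by (simp add: exp_add powr_def)
qed

text \<open>Bonami's two-point inequality for the values \<open>1 + a\<close> and
  \<open>1 - a\<close>, with its reversal for negative \<open>e\<close>: \<open>M\<close> is the
  squared norm of exponent \<open>1 + e\<close>. The logarithmic defect \<open>g\<close> vanishes at
  0 and is monotone, because its derivative has the sign of \<open>N\<close>.\<close>

lemma power_mean_gap:
  fixes e a :: real
  assumes e: "\<bar>e\<bar> < 1" and a: "0 \<le> a" "a \<le> 1"
  defines "M \<equiv> (((1 + a) powr (1 + e) + (1 - a) powr (1 + e)) / 2) powr (2 / (1 + e))"
  shows "0 \<le> e \<Longrightarrow> 1 + e * a\<^sup>2 \<le> M" "e \<le> 0 \<Longrightarrow> M \<le> 1 + e * a\<^sup>2"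
proof -
  define p where "p = 1 + e"
  have p: "p > 0" using e by (auto simp: p_def)
  define \<phi> where "\<phi> = (\<lambda>x. ((1 + x) powr p + (1 - x) powr p) / 2)"
  define g where "g = (\<lambda>x. ln (\<phi> x) - p / 2 * ln (1 + e * x\<^sup>2))"
  define N where "N = (\<lambda>x. (1 + x) powr e * (1 - e * x) - (1 - x) powr e * (1 + e * x))"
  have \<phi>_pos: "\<phi> x > 0" if "0 \<le> x" "x \<le> 1" for x
    using that by (auto simp: \<phi>_def intro!: add_pos_nonneg)
  have q_pos: "1 + e * x\<^sup>2 > 0" if "0 \<le> x" "x \<le> 1" for x
  proof -
    have "\<bar>e * x\<^sup>2\<bar> \<le> \<bar>e\<bar>" using that by (simp add: abs_mult mult_left_le power_le_one)
    then show ?thesis using e by linarith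
  qed
  \<comment> \<open>For \<open>a = 1\<close> the base \<open>1 - x\<close> vanishes at the right
    endpoint, so differentiability is used only on the open interval and continuity covers the
    ends.\<close>
  have powr_cont: "continuous_on {0..a} (\<lambda>x. h x powr p)"
    if "continuous_on {0..a} h" "\<And>x. x \<in> {0..a} \<Longrightarrow> h x \<ge> 0" for h :: "real \<Rightarrow> real"
    by (rule continuous_on_powr') (use that p in auto)
  have \<phi>_cont: "continuous_on {0..a} \<phi>"
    unfolding \<phi>_def using a
    by (intro continuous_on_divide continuous_on_add powr_cont) (auto intro: continuous_intros)
  have ln_cont: "continuous_on {0..a} (\<lambda>x. ln (h x))"
    if "continuous_on {0..a} h" "\<And>x. x \<in> {0..a} \<Longrightarrow> h x > 0" for h :: "real \<Rightarrow> real"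
    by (rule continuous_on_ln) (use that in fastforce)+
  have "continuous_on {0..a} (\<lambda>x. ln (\<phi> x))"
    using a by (intro ln_cont \<phi>_cont \<phi>_pos) auto
  moreover have "continuous_on {0..a} (\<lambda>x. ln (1 + e * x\<^sup>2))"
    using a by (intro ln_cont q_pos) (auto intro!: continuous_intros)
  ultimately have cont: "continuous_on {0..a} g"
    unfolding g_def by (intro continuous_on_diff continuous_on_mult continuous_on_const)
  have deriv: "(g has_real_derivative p * N x / (2 * \<phi> x * (1 + e * x\<^sup>2))) (at x)"
    if x: "0 < x" "x < 1" for x
  proof -
    have "(\<phi> has_real_derivative (p * (1 + x) powr (p - 1) - p * (1 - x) powr (p - 1)) / 2) (at x)"
      unfolding \<phi>_def using x by (auto intro!: derivative_eq_intros)
    then have "((\<lambda>x. ln (\<phi> x)) has_real_derivative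
        (p * (1 + x) powr (p - 1) - p * (1 - x) powr (p - 1)) / 2 / \<phi> x) (at x)"
      using \<phi>_pos[of x] x by (auto intro!: derivative_eq_intros)
    moreover have "((\<lambda>x. ln (1 + e * x\<^sup>2)) has_real_derivative e * (2 * x) / (1 + e * x\<^sup>2)) (at x)"
      using q_pos[of x] x by (auto intro!: derivative_eq_intros)
    ultimately have "(g has_real_derivative
        (p * (1 + x) powr (p - 1) - p * (1 - x) powr (p - 1)) / 2 / \<phi> x
          - p / 2 * (e * (2 * x) / (1 + e * x\<^sup>2))) (at x)"
      unfolding g_def by (intro DERIV_diff DERIV_cmult)
    moreover have "(p * (1 + x) powr (p - 1) - p * (1 - x) powr (p - 1)) / 2 / \<phi> x
          - p / 2 * (e * (2 * x) / (1 + e * x\<^sup>2)) = p * N x / (2 * \<phi> x * (1 + e * x\<^sup>2))"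
    proof -
      \<comment> \<open>Splitting each power of exponent \<open>p\<close> into a linear factor and a
        power of exponent \<open>e\<close> collapses the numerator over the common denominator to
        \<open>N x\<close>.\<close>
      have \<phi>2: "2 * \<phi> x = (1 + x) * (1 + x) powr e + (1 - x) * (1 - x) powr e"
        using x by (simp add: \<phi>_def p_def powr_add)
      have "((1 + x) powr e - (1 - x) powr e) * (1 + e * x\<^sup>2) - e * x * (2 * \<phi> x) = N x"
        unfolding \<phi>2 N_def by (simp add: algebra_simps power2_eq_square)
      then have "p * N x / (2 * \<phi> x * (1 + e * x\<^sup>2)) =
        p * (((1 + x) powr e - (1 - x) powr e) * (1 + e * x\<^sup>2) - e * x * (2 * \<phi> x)) / (2 * \<phi> x * (1 + e * x\<^sup>2))"
        by simp
      also have "\<dots> = p * ((1 + x) powr e - (1 - x) powr e) / (2 * \<phi> x) - p * (e * x) / (1 + e * x\<^sup>2)"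
        using \<phi>_pos[of x] q_pos[of x] x by (simp add: diff_frac_eq algebra_simps)
      finally have "p * N x / (2 * \<phi> x * (1 + e * x\<^sup>2)) =
        p * ((1 + x) powr e - (1 - x) powr e) / (2 * \<phi> x) - p * (e * x) / (1 + e * x\<^sup>2)" .
      moreover have "p / 2 * (e * (2 * x) / (1 + e * x\<^sup>2)) = p * (e * x) / (1 + e * x\<^sup>2)"
        by simp
      moreover have "(p * (1 + x) powr (p - 1) - p * (1 - x) powr (p - 1)) / 2 / \<phi> x
          = p * ((1 + x) powr e - (1 - x) powr e) / (2 * \<phi> x)"
        by (simp add: p_def right_diff_distrib)
      ultimately show ?thesis by (simp only:)
    qed
    ultimately show ?thesis by simp
  qed
  have g0: "g 0 = 0" by (simp add: g_def \<phi>_def)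
  have M: "M = exp (2 / p * ln (\<phi> a))"
    using \<phi>_pos[of a] a by (simp add: M_def \<phi>_def p_def powr_def)
  have E: "1 + e * a\<^sup>2 = exp (2 / p * (p / 2 * ln (1 + e * a\<^sup>2)))"
    using q_pos[of a] a p by simp
  {
    assume e0: "0 \<le> e"
    have "g 0 \<le> g a"
    proof (rule DERIV_nonneg_imp_increasing_open[OF a(1) _ cont])
      fix x assume x: "0 < x" "x < a"
      have "N x \<ge> 0" using powr_ratio_ge[of e x] e e0 x a by (simp add: N_def)
      then show "\<exists>y. (g has_real_derivative y) (at x) \<and> 0 \<le> y"
        using deriv[of x] \<phi>_pos[of x] q_pos[of x] x a p
        by (intro exI[of _ "p * N x / (2 * \<phi> x * (1 + e * x\<^sup>2))"]) auto
    qed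
    then have "p / 2 * ln (1 + e * a\<^sup>2) \<le> ln (\<phi> a)" using g0 by (simp add: g_def)
    then show "1 + e * a\<^sup>2 \<le> M"
      unfolding M by (subst E) (use p in \<open>simp add: field_simps\<close>)
  }
  {
    assume e0: "e \<le> 0"
    have "g 0 \<ge> g a"
    proof (rule DERIV_nonpos_imp_decreasing_open[OF a(1) _ cont])
      fix x assume x: "0 < x" "x < a"
      \<comment> \<open>For negative \<open>e\<close> the ratio inequality applies to
        \<open>- e\<close>; inverting the powers reverses the sign of \<open>N\<close>.\<close>
      have "(1 - x) powr (- e) * (1 - e * x) \<le> (1 + x) powr (- e) * (1 + e * x)"
        using powr_ratio_ge[of "- e" x] e e0 x a by simp
      then have "(1 - e * x) / (1 - x) powr e \<le> (1 + e * x) / (1 + x) powr e"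
        by (simp add: powr_minus_divide)
      then have "(1 - e * x) * (1 + x) powr e \<le> (1 + e * x) * (1 - x) powr e"
        using x a by (simp add: pos_divide_le_eq pos_le_divide_eq)
      then have "N x \<le> 0" by (simp add: N_def mult.commute)
      then show "\<exists>y. (g has_real_derivative y) (at x) \<and> y \<le> 0"
        using deriv[of x] \<phi>_pos[of x] q_pos[of x] x a p
        by (intro exI[of _ "p * N x / (2 * \<phi> x * (1 + e * x\<^sup>2))"])
           (auto intro!: divide_nonpos_pos mult_nonneg_nonpos)
    qed
    then have "p / 2 * ln (1 + e * a\<^sup>2) \<ge> ln (\<phi> a)" using g0 by (simp add: g_def)
    then show "M \<le> 1 + e * a\<^sup>2"
      unfolding M by (subst E) (use p in \<open>simp add: field_simps\<close>)
  }
qed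

text \<open>Both sides are symmetric and homogeneous of degree 2, so ordering
  \<open>v \<le> u\<close> and dividing by the mean \<open>m\<close> leaves the normalised
  inequality with \<open>a = (u - v) / (u + v)\<close>.\<close>

lemma two_point_power_mean:
  fixes e u v :: real
  assumes e: "\<bar>e\<bar> < 1" and uv: "0 \<le> u" "0 \<le> v"
  defines "M \<equiv> ((u powr (1 + e) + v powr (1 + e)) / 2) powr (2 / (1 + e))"
    and "q \<equiv> ((u + v) / 2)\<^sup>2 + e * ((u - v) / 2)\<^sup>2"
  shows "0 \<le> e \<Longrightarrow> q \<le> M" "e \<le> 0 \<Longrightarrow> M \<le> q"
proof -
  have *: "(0 \<le> e \<longrightarrow> ((u + v) / 2)\<^sup>2 + e * ((u - v) / 2)\<^sup>2 \<le> ((u powr (1 + e) + v powr (1 + e)) / 2) powr (2 / (1 + e))) \<and>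
     (e \<le> 0 \<longrightarrow> ((u powr (1 + e) + v powr (1 + e)) / 2) powr (2 / (1 + e)) \<le> ((u + v) / 2)\<^sup>2 + e * ((u - v) / 2)\<^sup>2)"
    if vu: "0 \<le> v" "v \<le> u" for u v
  proof (cases "u = 0")
    case True
    then show ?thesis using vu by simp
  next
    case False
    define m where "m = (u + v) / 2"
    define a where "a = (u - v) / (u + v)"
    have m: "m > 0" using False vu by (simp add: m_def)
    have a: "0 \<le> a" "a \<le> 1" using vu False by (auto simp: a_def)
    have "u + v \<noteq> 0" using vu False by simp
    then have u: "u = m * (1 + a)" and v: "v = m * (1 - a)"
      by (simp_all add: m_def a_def field_simps)
    have p: "1 + e > 0" using e by auto
    have mm: "((u powr (1 + e) + v powr (1 + e)) / 2) = m powr (1 + e) * (((1 + a) powr (1 + e) + (1 - a) powr (1 + e)) / 2)"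
      unfolding u v using m a by (simp only: powr_mult) (simp add: field_simps)
    have "((u powr (1 + e) + v powr (1 + e)) / 2) powr (2 / (1 + e)) =
        (m powr (1 + e)) powr (2 / (1 + e)) * ((((1 + a) powr (1 + e) + (1 - a) powr (1 + e)) / 2)) powr (2 / (1 + e))"
      unfolding mm by (simp only: powr_mult)
    also have "(m powr (1 + e)) powr (2 / (1 + e)) = m\<^sup>2"
    proof -
      have "1 + e \<noteq> 0" using p by simp
      then have "(1 + e) * (2 / (1 + e)) = 2"
        by (subst times_divide_eq_right) (rule nonzero_mult_div_cancel_left)
      then show ?thesis using m by (simp only: powr_powr) simp
    qed
    finally have 1: "((u powr (1 + e) + v powr (1 + e)) / 2) powr (2 / (1 + e)) =
        m\<^sup>2 * ((((1 + a) powr (1 + e) + (1 - a) powr (1 + e)) / 2)) powr (2 / (1 + e))" .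
    have 2: "((u + v) / 2)\<^sup>2 + e * ((u - v) / 2)\<^sup>2 = m\<^sup>2 * (1 + e * a\<^sup>2)"
      unfolding u v by (simp add: field_simps power2_eq_square)
    show ?thesis
      unfolding 1 2 using power_mean_gap[OF e a] m by auto
  qed
  have "(0 \<le> e \<longrightarrow> q \<le> M) \<and> (e \<le> 0 \<longrightarrow> M \<le> q)"
  proof (cases "v \<le> u")
    case True
    then show ?thesis using *[OF uv(2)] unfolding M_def q_def by simp
  next
    case False
    then show ?thesis using *[OF uv(1), of v] unfolding M_def q_def
      by (simp add: add.commute power2_commute[of u v] diff_divide_distrib[symmetric] power_divide)
  qed
  then show "0 \<le> e \<Longrightarrow> q \<le> M" "e \<le> 0 \<Longrightarrow> M \<le> q" by auto
qed

text \<open>In terms of half sums \<open>m, m'\<close> and half differences \<open>d, d'\<close> the kernel is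
  \<open>2 ((\<beta> + \<gamma>) m m' + (\<gamma> - \<beta>) d d')\<close>, so Cauchy--Schwarz reduces the bilinear bounds to
  the power mean inequality for each factor.\<close>
lemma two_point_upper:
  fixes \<beta> \<gamma> r x0 x1 y0 y1 :: real
  assumes r: "0 \<le> r" "r < 1" and bg: "\<bar>\<beta> - \<gamma>\<bar> \<le> r * (\<beta> + \<gamma>)"
    and B: "0 \<le> \<beta> + \<gamma>"
    and nn: "0 \<le> x0" "0 \<le> x1" "0 \<le> y0" "0 \<le> y1"
  defines "s \<equiv> 1 / (1 + r)"
  shows "\<gamma> * (x1 powr s * y1 powr s) + \<beta> * (x1 powr s * y0 powr s)
       + \<beta> * (x0 powr s * y1 powr s) + \<gamma> * (x0 powr s * y0 powr s)
    \<le> 2 * (\<beta> + \<gamma>) * (((x0 + x1) / 2) powr s * ((y0 + y1) / 2) powr s)"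
proof -
  \<comment> \<open>The power mean inequality is applied to the powers with exponent
    \<open>s\<close>: raising them to \<open>1 + r = 1 / s\<close> returns \<open>x0\<close> and
    \<open>x1\<close>, so a plain average appears on the right.\<close>
  have mean: "\<exists>m d. x1 powr s = m + d \<and> x0 powr s = m - d \<and> m \<ge> 0 \<and>
      m\<^sup>2 + r * d\<^sup>2 \<le> (((x0 + x1) / 2) powr s)\<^sup>2" if "0 \<le> x0" "0 \<le> x1" for x0 x1 :: real
  proof (intro exI conjI)
    let ?m = "(x1 powr s + x0 powr s) / 2" and ?d = "(x1 powr s - x0 powr s) / 2"
    show "x1 powr s = ?m + ?d" "x0 powr s = ?m - ?d" "?m \<ge> 0" by (simp_all add: field_simps)
    have "(x powr s) powr (1 + r) = x" if "0 \<le> x" for x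
      using that r by (simp add: s_def powr_powr)
    moreover have "(((x1 + x0) / 2) powr s)\<^sup>2 = ((x1 + x0) / 2) powr (2 / (1 + r))"
    proof -
      have "2 / (1 + r) = s + s" by (simp add: s_def)
      then show ?thesis by (simp only: powr_add power2_eq_square)
    qed
    ultimately show "?m\<^sup>2 + r * ?d\<^sup>2 \<le> (((x0 + x1) / 2) powr s)\<^sup>2"
      using two_point_power_mean(1)[of r "x1 powr s" "x0 powr s"] r that by (simp add: add.commute)
  qed
  obtain m d where md: "x1 powr s = m + d" "x0 powr s = m - d" "m \<ge> 0"
      "m\<^sup>2 + r * d\<^sup>2 \<le> (((x0 + x1) / 2) powr s)\<^sup>2" using mean[OF nn(1,2)] by blast
  obtain m' d' where md': "y1 powr s = m' + d'" "y0 powr s = m' - d'" "m' \<ge> 0"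
      "m'\<^sup>2 + r * d'\<^sup>2 \<le> (((y0 + y1) / 2) powr s)\<^sup>2" using mean[OF nn(3,4)] by blast
  have "(\<gamma> - \<beta>) * (d * d') \<le> \<bar>\<beta> - \<gamma>\<bar> * \<bar>d * d'\<bar>"
    using abs_ge_self[of "(\<gamma> - \<beta>) * (d * d')"] by (simp only: abs_mult abs_minus_commute[of \<gamma>])
  also have "\<dots> \<le> r * (\<beta> + \<gamma>) * \<bar>d * d'\<bar>" using bg by (intro mult_right_mono) auto
  finally have 1: "(\<beta> + \<gamma>) * (m * m') + (\<gamma> - \<beta>) * (d * d') \<le> (\<beta> + \<gamma>) * (m * m' + r * \<bar>d * d'\<bar>)"
    by (simp add: algebra_simps)
  \<comment> \<open>Cauchy--Schwarz for the form \<open>m\<^sup>2 + r * d\<^sup>2\<close>; the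
    defect is \<open>r\<close> times an explicit square.\<close>
  have "(m * m' + r * \<bar>d * d'\<bar>)\<^sup>2 \<le> (m\<^sup>2 + r * d\<^sup>2) * (m'\<^sup>2 + r * d'\<^sup>2)"
  proof -
    have "(m\<^sup>2 + r * d\<^sup>2) * (m'\<^sup>2 + r * d'\<^sup>2) - (m * m' + r * \<bar>d * d'\<bar>)\<^sup>2 = r * (m * \<bar>d'\<bar> - m' * \<bar>d\<bar>)\<^sup>2"
      by (simp add: power2_eq_square abs_mult algebra_simps)
    moreover have "r * (m * \<bar>d'\<bar> - m' * \<bar>d\<bar>)\<^sup>2 \<ge> 0" using r by simp
    ultimately show ?thesis by linarith
  qed
  also have "\<dots> \<le> (((x0 + x1) / 2) powr s)\<^sup>2 * (((y0 + y1) / 2) powr s)\<^sup>2"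
    using md(4) md'(4) r by (intro mult_mono) auto
  finally have "(m * m' + r * \<bar>d * d'\<bar>)\<^sup>2 \<le> (((x0 + x1) / 2) powr s * ((y0 + y1) / 2) powr s)\<^sup>2"
    by (simp only: power_mult_distrib)
  then have "m * m' + r * \<bar>d * d'\<bar> \<le> ((x0 + x1) / 2) powr s * ((y0 + y1) / 2) powr s"
    by (rule power2_le_imp_le) simp
  from mult_left_mono[OF this B] 1 show ?thesis
    unfolding md md' by (simp add: algebra_simps)
qed

text \<open>The difference term is replaced by its worst sign. The form
  \<open>m\<^sup>2 - r * d\<^sup>2\<close> is indefinite, so Cauchy--Schwarz runs in the opposite
  direction; \<open>\<bar>d\<bar> \<le> m\<close> keeps
  \<open>m * m' - r * \<bar>d * d'\<bar>\<close> nonnegative, which permits taking roots at the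
  end.\<close>

lemma two_point_lower:
  fixes \<beta> \<gamma> r x0 x1 y0 y1 :: real
  assumes r: "0 \<le> r" "r < 1" and bg: "\<bar>\<beta> - \<gamma>\<bar> \<le> r * (\<beta> + \<gamma>)"
    and B: "0 \<le> \<beta> + \<gamma>"
    and nn: "0 \<le> x0" "0 \<le> x1" "0 \<le> y0" "0 \<le> y1"
  defines "s \<equiv> 1 / (1 - r)"
  shows "2 * (\<beta> + \<gamma>) * (((x0 + x1) / 2) powr s * ((y0 + y1) / 2) powr s)
    \<le> \<gamma> * (x1 powr s * y1 powr s) + \<beta> * (x1 powr s * y0 powr s)
       + \<beta> * (x0 powr s * y1 powr s) + \<gamma> * (x0 powr s * y0 powr s)"
proof -
  have mean: "\<exists>m d. x1 powr s = m + d \<and> x0 powr s = m - d \<and> m \<ge> \<bar>d\<bar> \<and>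
      (((x0 + x1) / 2) powr s)\<^sup>2 \<le> m\<^sup>2 - r * d\<^sup>2" if "0 \<le> x0" "0 \<le> x1" for x0 x1 :: real
  proof (intro exI conjI)
    let ?m = "(x1 powr s + x0 powr s) / 2" and ?d = "(x1 powr s - x0 powr s) / 2"
    show "x1 powr s = ?m + ?d" "x0 powr s = ?m - ?d" by (simp_all add: field_simps)
    show "\<bar>?d\<bar> \<le> ?m"
      using powr_ge_zero[of x1 s] powr_ge_zero[of x0 s] by (simp add: abs_le_iff field_simps)
    have "(x powr s) powr (1 - r) = x" if "0 \<le> x" for x
      using that r by (simp add: s_def powr_powr)
    moreover have "(((x1 + x0) / 2) powr s)\<^sup>2 = ((x1 + x0) / 2) powr (2 / (1 - r))"
    proof -
      have "2 / (1 - r) = s + s" by (simp add: s_def)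
      then show ?thesis by (simp only: powr_add power2_eq_square)
    qed
    ultimately show "(((x0 + x1) / 2) powr s)\<^sup>2 \<le> ?m\<^sup>2 - r * ?d\<^sup>2"
      using two_point_power_mean(2)[of "- r" "x1 powr s" "x0 powr s"] r that by (simp add: add.commute)
  qed
  obtain m d where md: "x1 powr s = m + d" "x0 powr s = m - d" "m \<ge> \<bar>d\<bar>"
      "(((x0 + x1) / 2) powr s)\<^sup>2 \<le> m\<^sup>2 - r * d\<^sup>2" using mean[OF nn(1,2)] by blast
  obtain m' d' where md': "y1 powr s = m' + d'" "y0 powr s = m' - d'" "m' \<ge> \<bar>d'\<bar>"
      "(((y0 + y1) / 2) powr s)\<^sup>2 \<le> m'\<^sup>2 - r * d'\<^sup>2" using mean[OF nn(3,4)] by blast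
  have "(\<beta> - \<gamma>) * (d * d') \<le> \<bar>\<beta> - \<gamma>\<bar> * \<bar>d * d'\<bar>"
    using abs_ge_self[of "(\<beta> - \<gamma>) * (d * d')"] by (simp only: abs_mult)
  also have "\<dots> \<le> r * (\<beta> + \<gamma>) * \<bar>d * d'\<bar>" using bg by (intro mult_right_mono) auto
  finally have 1: "(\<beta> + \<gamma>) * (m * m' - r * \<bar>d * d'\<bar>) \<le> (\<beta> + \<gamma>) * (m * m') + (\<gamma> - \<beta>) * (d * d')"
    by (simp add: algebra_simps)
  have dd: "r * \<bar>d * d'\<bar> \<le> m * m'"
  proof -
    have "r * \<bar>d * d'\<bar> \<le> \<bar>d\<bar> * \<bar>d'\<bar>" using r by (simp add: abs_mult mult_left_le_one_le)
    also have "\<dots> \<le> m * m'" using md(3) md'(3) by (intro mult_mono) auto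
    finally show ?thesis .
  qed
  have "(((x0 + x1) / 2) powr s)\<^sup>2 * (((y0 + y1) / 2) powr s)\<^sup>2 \<le> (m\<^sup>2 - r * d\<^sup>2) * (m'\<^sup>2 - r * d'\<^sup>2)"
  proof (rule mult_mono[OF md(4) md'(4)])
    show "0 \<le> m\<^sup>2 - r * d\<^sup>2" using md(4) by (meson order_trans zero_le_power2)
  qed simp
  also have "\<dots> \<le> (m * m' - r * \<bar>d * d'\<bar>)\<^sup>2"
  proof -
    have "(m * m' - r * \<bar>d * d'\<bar>)\<^sup>2 - (m\<^sup>2 - r * d\<^sup>2) * (m'\<^sup>2 - r * d'\<^sup>2) = r * (m * \<bar>d'\<bar> - m' * \<bar>d\<bar>)\<^sup>2"
      by (simp add: power2_eq_square abs_mult algebra_simps)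
    moreover have "r * (m * \<bar>d'\<bar> - m' * \<bar>d\<bar>)\<^sup>2 \<ge> 0" using r by simp
    ultimately show ?thesis by linarith
  qed
  finally have "(((x0 + x1) / 2) powr s * ((y0 + y1) / 2) powr s)\<^sup>2 \<le> (m * m' - r * \<bar>d * d'\<bar>)\<^sup>2"
    by (simp only: power_mult_distrib)
  then have "((x0 + x1) / 2) powr s * ((y0 + y1) / 2) powr s \<le> m * m' - r * \<bar>d * d'\<bar>"
    by (rule power2_le_imp_le) (use dd in simp)
  from mult_left_mono[OF this B] 1 show ?thesis
    unfolding md md' by (simp add: algebra_simps)
qed

subsection \<open>Expected numbers of edges between sets\<close>

text \<open>For disjoint \<open>X\<close> and \<open>Y\<close> this is the expected number of edges
  between them. For overlapping sets it is a sum over ordered pairs that includes the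
  diagonal.\<close>

definition kron_mass :: "nat \<Rightarrow> (bool \<Rightarrow> bool \<Rightarrow> real) \<Rightarrow> bool list set \<Rightarrow> bool list set \<Rightarrow> real" where
  "kron_mass n P X Y = (\<Sum>x\<in>X. \<Sum>y\<in>Y. kron_prob n P x y)"

lemma finite_cube: "finite (cube n)"
  using finite_lists_length_eq[of "UNIV :: bool set" n] by (simp add: cube_def)

lemma card_cube: "card (cube n) = 2 ^ n"
  using card_lists_length_eq[of "UNIV :: bool set" n] by (simp add: cube_def)

lemma kron_prob_Cons:
  "kron_prob (Suc n) P (a # x) (b # y) = P a b * kron_prob n P x y"
  by (simp add: kron_prob_def prod.lessThan_Suc_shift del: prod.lessThan_Suc)

lemma vimage_Cons_subset_cube: "X \<subseteq> cube (Suc n) \<Longrightarrow> Cons a -` X \<subseteq> cube n"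
  by (auto simp: cube_def)

lemma sum_cube_Suc:
  fixes f :: "bool list \<Rightarrow> 'b :: comm_monoid_add"
  assumes "X \<subseteq> cube (Suc n)"
  shows "(\<Sum>x\<in>X. f x) = (\<Sum>x\<in>Cons True -` X. f (True # x)) + (\<Sum>x\<in>Cons False -` X. f (False # x))"
proof -
  have fin: "finite X"
    using assms finite_cube finite_subset by blast
  have X: "X = Cons True ` (Cons True -` X) \<union> Cons False ` (Cons False -` X)"
  proof (intro equalityI subsetI)
    fix x assume x: "x \<in> X"
    then obtain a y where "x = a # y"
      using assms by (cases x) (auto simp: cube_def)
    then show "x \<in> Cons True ` (Cons True -` X) \<union> Cons False ` (Cons False -` X)"
      using x by (cases a) auto
  qed auto
  have "(\<Sum>x\<in>X. f x) = sum f (Cons True ` (Cons True -` X)) + sum f (Cons False ` (Cons False -` X))"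
    by (subst X, subst sum.union_disjoint) (use fin in auto)
  then show ?thesis by (simp add: sum.reindex del: image_vimage_eq)
qed

lemma card_cube_Suc:
  assumes "X \<subseteq> cube (Suc n)"
  shows "card X = card (Cons False -` X) + card (Cons True -` X)"
  using sum_cube_Suc[OF assms, of "\<lambda>_. 1 :: nat"] by simp

lemma kron_mass_Suc:
  assumes "X \<subseteq> cube (Suc n)" "Y \<subseteq> cube (Suc n)"
  shows "kron_mass (Suc n) P X Y =
    P True True * kron_mass n P (Cons True -` X) (Cons True -` Y)
    + P True False * kron_mass n P (Cons True -` X) (Cons False -` Y)
    + P False True * kron_mass n P (Cons False -` X) (Cons True -` Y)
    + P False False * kron_mass n P (Cons False -` X) (Cons False -` Y)"
  unfolding kron_mass_def
  by (simp add: sum_cube_Suc[OF assms(1)] sum_cube_Suc[OF assms(2)] kron_prob_Cons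
      sum.distrib sum_distrib_left)

text \<open>Both cardinalities are 0 or 1, and these are fixed by every exponent since
  \<open>0 powr s = 0\<close>. The same base case thus serves the upper and the lower bound.\<close>

lemma kron_mass_0:
  assumes "X \<subseteq> cube 0" "Y \<subseteq> cube 0"
  shows "kron_mass 0 P X Y = (real (card X)) powr s * (real (card Y)) powr s"
proof -
  have "X = {} \<or> X = {[]}" "Y = {} \<or> Y = {[]}" using assms by (auto simp: cube_def)
  then show ?thesis by (auto simp: kron_mass_def kron_prob_def)
qed

text \<open>Tensorisation: fixing the first coordinates splits the mass into four masses one
  dimension lower. The induction hypothesis bounds each by the section densities \<open>x a\<close>,
  \<open>y b\<close>, and the two-point inequality recombines them, the average of the section
  densities being the full density.\<close>

lemma kron_mass_upper:
  fixes \<beta> \<gamma> r :: real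
  assumes r: "0 \<le> r" "r < 1" and bg: "\<bar>\<beta> - \<gamma>\<bar> \<le> r * (\<beta> + \<gamma>)" and nn: "0 \<le> \<beta>" "0 \<le> \<gamma>"
    and XY: "X \<subseteq> cube n" "Y \<subseteq> cube n"
  shows "kron_mass n (kron_matrix \<gamma> \<beta> \<gamma>) X Y \<le>
    (2 * (\<beta> + \<gamma>)) ^ n * ((real (card X) / 2 ^ n) powr (1 / (1 + r)) * (real (card Y) / 2 ^ n) powr (1 / (1 + r)))"
  using XY
proof (induction n arbitrary: X Y)
  case 0
  then show ?case using kron_mass_0[OF 0, of _ "1 / (1 + r)"] by simp
next
  case (Suc n)
  let ?s = "1 / (1 + r)" and ?P = "kron_matrix \<gamma> \<beta> \<gamma>" and ?C = "(2 * (\<beta> + \<gamma>)) ^ n"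
  define x where "x = (\<lambda>a. real (card (Cons a -` X)) / 2 ^ n)"
  define y where "y = (\<lambda>a. real (card (Cons a -` Y)) / 2 ^ n)"
  have IH: "kron_mass n ?P (Cons a -` X) (Cons b -` Y) \<le> ?C * (x a powr ?s * y b powr ?s)" for a b
    unfolding x_def y_def using Suc.prems by (intro Suc.IH vimage_Cons_subset_cube)
  have "kron_mass (Suc n) ?P X Y \<le>
     \<gamma> * (?C * (x True powr ?s * y True powr ?s)) + \<beta> * (?C * (x True powr ?s * y False powr ?s))
     + \<beta> * (?C * (x False powr ?s * y True powr ?s)) + \<gamma> * (?C * (x False powr ?s * y False powr ?s))"
    unfolding kron_mass_Suc[OF Suc.prems] kron_matrix.simps
    by (intro add_mono mult_left_mono IH nn)
  also have "\<dots> = ?C * (\<gamma> * (x True powr ?s * y True powr ?s) + \<beta> * (x True powr ?s * y False powr ?s)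
     + \<beta> * (x False powr ?s * y True powr ?s) + \<gamma> * (x False powr ?s * y False powr ?s))"
    by (simp only: distrib_left mult.left_commute)
  also have "\<dots> \<le> ?C * (2 * (\<beta> + \<gamma>) * (((x False + x True) / 2) powr ?s * ((y False + y True) / 2) powr ?s))"
    by (intro mult_left_mono two_point_upper[OF r bg]) (use nn in \<open>simp_all add: x_def y_def\<close>)
  also have "(x False + x True) / 2 = card X / 2 ^ Suc n"
    by (simp add: card_cube_Suc[OF Suc.prems(1)] x_def add_divide_distrib)
  also have "(y False + y True) / 2 = card Y / 2 ^ Suc n"
    by (simp add: card_cube_Suc[OF Suc.prems(2)] y_def add_divide_distrib)
  finally show ?case by (simp add: mult_ac)
qed

text \<open>Reverse hypercontractivity by the same induction on the first coordinate, now
  recombining with \<open>two_point_lower\<close>.\<close>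

lemma kron_mass_lower:
  fixes \<beta> \<gamma> r :: real
  assumes r: "0 \<le> r" "r < 1" and bg: "\<bar>\<beta> - \<gamma>\<bar> \<le> r * (\<beta> + \<gamma>)" and nn: "0 \<le> \<beta>" "0 \<le> \<gamma>"
    and XY: "X \<subseteq> cube n" "Y \<subseteq> cube n"
  shows "(2 * (\<beta> + \<gamma>)) ^ n * ((real (card X) / 2 ^ n) powr (1 / (1 - r)) * (real (card Y) / 2 ^ n) powr (1 / (1 - r)))
    \<le> kron_mass n (kron_matrix \<gamma> \<beta> \<gamma>) X Y"
  using XY
proof (induction n arbitrary: X Y)
  case 0
  then show ?case using kron_mass_0[OF 0, of _ "1 / (1 - r)"] by simp
next
  case (Suc n)
  let ?s = "1 / (1 - r)" and ?P = "kron_matrix \<gamma> \<beta> \<gamma>" and ?C = "(2 * (\<beta> + \<gamma>)) ^ n"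
  define x where "x = (\<lambda>a. real (card (Cons a -` X)) / 2 ^ n)"
  define y where "y = (\<lambda>a. real (card (Cons a -` Y)) / 2 ^ n)"
  have IH: "?C * (x a powr ?s * y b powr ?s) \<le> kron_mass n ?P (Cons a -` X) (Cons b -` Y)" for a b
    unfolding x_def y_def using Suc.prems by (intro Suc.IH vimage_Cons_subset_cube)
  have X: "real (card X) / 2 ^ Suc n = (x False + x True) / 2"
    by (simp add: card_cube_Suc[OF Suc.prems(1)] x_def add_divide_distrib)
  have Y: "real (card Y) / 2 ^ Suc n = (y False + y True) / 2"
    by (simp add: card_cube_Suc[OF Suc.prems(2)] y_def add_divide_distrib)
  have "(2 * (\<beta> + \<gamma>)) ^ Suc n * ((real (card X) / 2 ^ Suc n) powr ?s * (real (card Y) / 2 ^ Suc n) powr ?s)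
     = ?C * (2 * (\<beta> + \<gamma>) * (((x False + x True) / 2) powr ?s * ((y False + y True) / 2) powr ?s))"
    unfolding X Y by (simp only: power_Suc mult_ac)
  also have "?C * (2 * (\<beta> + \<gamma>) * (((x False + x True) / 2) powr ?s * ((y False + y True) / 2) powr ?s))
     \<le> ?C * (\<gamma> * (x True powr ?s * y True powr ?s) + \<beta> * (x True powr ?s * y False powr ?s)
     + \<beta> * (x False powr ?s * y True powr ?s) + \<gamma> * (x False powr ?s * y False powr ?s))"
    by (intro mult_left_mono two_point_lower[OF r bg]) (use nn in \<open>simp_all add: x_def y_def\<close>)
  also have "\<dots> = \<gamma> * (?C * (x True powr ?s * y True powr ?s)) + \<beta> * (?C * (x True powr ?s * y False powr ?s))
     + \<beta> * (?C * (x False powr ?s * y True powr ?s)) + \<gamma> * (?C * (x False powr ?s * y False powr ?s))"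
    by (simp only: distrib_left mult.left_commute)
  also have "\<dots> \<le> kron_mass (Suc n) ?P X Y"
    unfolding kron_mass_Suc[OF Suc.prems] kron_matrix.simps
    by (intro add_mono mult_left_mono IH nn)
  finally show ?case .
qed

section \<open>Expected degrees inside the middle layer\<close>

text \<open>Generating function by weight: each coordinate of \<open>x\<close> contributes a linear
  polynomial whose variable marks a \<open>True\<close> entry of \<open>y\<close>.\<close>

lemma sum_kron_prob_weight:
  assumes "length x = n"
  shows "(\<Sum>y\<in>{y \<in> cube n. weight y = w}. kron_prob n P x y)
    = coeff (\<Prod>a\<leftarrow>x. [:P a False, P a True:]) w"
  using assms
proof (induction x arbitrary: n w)
  case Nil
  have "{y \<in> cube 0. weight y = w} = (if w = 0 then {[]} else {})"
    by (auto simp: cube_def weight_def)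
  then show ?case using Nil by (simp add: kron_prob_def)
next
  case (Cons a x)
  then obtain k where n: "n = Suc k" and k: "length x = k" by auto
  let ?Y = "\<lambda>k w. {y \<in> cube k. weight y = w}"
  have "Cons True -` ?Y n w = (case w of 0 \<Rightarrow> {} | Suc v \<Rightarrow> ?Y k v)"
    by (auto simp: n cube_def weight_def split: nat.splits)
  moreover have "Cons False -` ?Y n w = ?Y k w"
    by (auto simp: n cube_def weight_def)
  moreover have "?Y n w \<subseteq> cube (Suc k)" by (auto simp: n)
  note sum_cube_Suc[OF this, of "kron_prob n P (a # x)"]
  ultimately have "(\<Sum>y\<in>?Y n w. kron_prob n P (a # x) y) =
      P a True * (case w of 0 \<Rightarrow> 0 | Suc v \<Rightarrow> (\<Sum>y\<in>?Y k v. kron_prob k P x y))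
      + P a False * (\<Sum>y\<in>?Y k w. kron_prob k P x y)"
    by (simp only: n kron_prob_Cons sum_distrib_left[symmetric]) (simp split: nat.splits)
  then show ?case
    by (simp add: Cons.IH[OF k] mult_pCons_left coeff_pCons algebra_simps split: nat.splits)
qed

lemma weight_le_length: "weight x \<le> length x"
  by (induction x) (auto simp: weight_def)

lemma prod_list_weight:
  fixes f :: "bool \<Rightarrow> 'a :: comm_monoid_mult"
  shows "(\<Prod>a\<leftarrow>x. f a) = f True ^ weight x * f False ^ (length x - weight x)"
proof (induction x)
  case (Cons a x)
  have "Suc (length x) - weight x = Suc (length x - weight x)"
    using weight_le_length[of x] by simp
  then show ?case using Cons by (cases a) (simp_all add: weight_def mult_ac)
qed (simp add: weight_def)

text \<open>The mass from \<open>x\<close> to the whole cube is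
  \<open>(\<beta> + \<gamma>) ^ n\<close>. Its middle-layer part is the sum of squares of the
  binomial terms \<open>c i\<close> of \<open>(\<beta> + \<gamma>) ^ (n div 2)\<close>, so passing
  to the layer costs only a polynomial factor.\<close>

lemma middle_layer_mass_ge:
  fixes \<beta> \<gamma> :: real
  assumes n: "even n" and x: "x \<in> middle_layer n"
  shows "(\<beta> + \<gamma>) ^ n / (n + 1) \<le> (\<Sum>y\<in>middle_layer n. kron_prob n (kron_matrix \<gamma> \<beta> \<gamma>) x y)"
proof -
  define m where "m = n div 2"
  define c where "c = (\<lambda>i. real (m choose i) * \<gamma> ^ i * \<beta> ^ (m - i))"
  have n2: "n = 2 * m" using n by (simp add: m_def)
  have lx: "length x = n" "weight x = m" using x by (auto simp: middle_layer_def cube_def m_def)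
  have "(\<Sum>y\<in>middle_layer n. kron_prob n (kron_matrix \<gamma> \<beta> \<gamma>) x y) = coeff ([:\<beta>, \<gamma>:] ^ m * [:\<gamma>, \<beta>:] ^ m) m"
    unfolding middle_layer_def m_def[symmetric] sum_kron_prob_weight[OF lx(1)] prod_list_weight lx
    by (simp add: n2)
  \<comment> \<open>The two linear polynomials are reversals of each other, so coefficient
    \<open>i\<close> of one power equals coefficient \<open>m - i\<close> of the other.\<close>
  also have "\<dots> = (\<Sum>i\<le>m. c i * c i)"
    unfolding coeff_mult c_def
    by (intro sum.cong refl) (auto simp: coeff_linear_poly_power binomial_symmetric[symmetric] mult_ac)
  finally have eq: "(\<Sum>y\<in>middle_layer n. kron_prob n (kron_matrix \<gamma> \<beta> \<gamma>) x y) = (\<Sum>i\<le>m. (c i)\<^sup>2)"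
    by (simp add: power2_eq_square)
  have "(\<gamma> + \<beta>) ^ m = (\<Sum>i\<le>m. c i)"
    by (simp add: binomial_ring c_def)
  then have "(\<beta> + \<gamma>) ^ n = (\<Sum>i\<le>m. c i)\<^sup>2"
    by (simp add: n2 power_even_eq add.commute)
  \<comment> \<open>Cauchy--Schwarz over the \<open>m + 1\<close> terms.\<close>
  also have "\<dots> \<le> (\<Sum>i\<le>m. (c i)\<^sup>2) * (m + 1)"
    using sum_squared_le_sum_of_squares[of c "{..m}"] by simp
  also have "\<dots> \<le> (\<Sum>i\<le>m. (c i)\<^sup>2) * (n + 1)"
    by (intro mult_left_mono sum_nonneg) (auto simp: n2)
  finally show ?thesis unfolding eq by (simp add: divide_le_eq)
qed

subsection \<open>Expansion with high probability\<close>

text \<open>\<open>S\<close> stands for any set containing the closed neighbourhood of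
  \<open>X\<close>. Quantifying over fixed pairs \<open>X\<close>, \<open>S\<close> makes failure a
  union of events that each forbid a fixed set of edges; the factor \<open>2 * n\<close> is the room
  needed for the union bound.\<close>

definition expanding :: "nat \<Rightarrow> (bool \<Rightarrow> bool \<Rightarrow> real) \<Rightarrow> bool list set \<Rightarrow> (bool list set \<Rightarrow> bool) \<Rightarrow> bool" where
  "expanding n P V f \<longleftrightarrow> (\<forall>X S. X \<subseteq> S \<and> S \<subseteq> V \<and> X \<noteq> {} \<and> (\<forall>x\<in>X. \<forall>y\<in>V - S. \<not> f {x, y})
     \<longrightarrow> kron_mass n P X (V - S) \<le> 2 * real n * real (card S))"

text \<open>Disjointness makes distinct pairs \<open>(x, y)\<close> give distinct edges, so
  independence turns the probability into a product of factors
  \<open>1 - p \<le> exp (- p)\<close>.\<close>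

lemma prob_no_edges_le:
  assumes P: "\<And>a b. P a b = P b a" "\<And>a b. P a b \<in> {0..1}"
    and XY: "X \<subseteq> cube n" "Y \<subseteq> cube n" "X \<inter> Y = {}"
  defines "Q \<equiv> Pi_pmf (vertex_pairs n) False (\<lambda>e. bernoulli_pmf (kron_edge_prob n P e))"
  shows "measure_pmf.prob Q {f. \<forall>x\<in>X. \<forall>y\<in>Y. \<not> f {x, y}} \<le> exp (- kron_mass n P X Y)"
proof -
  define E where "E = (\<lambda>(x, y). {x, y}) ` (X \<times> Y)"
  have inj: "inj_on (\<lambda>(x, y). {x, y}) (X \<times> Y)"
    using XY(3) by (auto simp: inj_on_def doubleton_eq_iff)
  have E: "E \<subseteq> vertex_pairs n"
    using XY by (auto simp: E_def vertex_pairs_def) blast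
  have p: "kron_prob n P u v \<in> {0..1}" for u v
    unfolding kron_prob_def using P(2) by (auto intro!: prod_nonneg prod_le_1)
  have p': "kron_edge_prob n P e \<in> {0..1}" if "e \<in> E" for e
    using that p by (auto simp: E_def kron_edge_prob_pair[OF P(1)])
  \<comment> \<open>The event is enlarged to a box, constrained on \<open>E\<close> and free
    elsewhere, so that coordinates outside \<open>E\<close> contribute factor 1.\<close>
  define B where "B = (\<lambda>e. if e \<in> E then {False} else UNIV)"
  have "measure_pmf.prob Q {f. \<forall>x\<in>X. \<forall>y\<in>Y. \<not> f {x, y}} \<le> measure_pmf.prob Q (Pi (vertex_pairs n) B)"
    by (intro measure_pmf.finite_measure_mono) (auto simp: B_def E_def)
  also have "\<dots> = (\<Prod>e\<in>vertex_pairs n. measure_pmf.prob (bernoulli_pmf (kron_edge_prob n P e)) (B e))"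
    unfolding Q_def by (intro measure_Pi_pmf_Pi finite_vertex_pairs)
  also have "\<dots> = (\<Prod>e\<in>E. measure_pmf.prob (bernoulli_pmf (kron_edge_prob n P e)) (B e))"
    using E by (intro prod.mono_neutral_right finite_vertex_pairs) (auto simp: B_def)
  also have "\<dots> \<le> (\<Prod>e\<in>E. exp (- kron_edge_prob n P e))"
  proof (intro prod_mono conjI)
    fix e assume e: "e \<in> E"
    have "measure_pmf.prob (bernoulli_pmf (kron_edge_prob n P e)) (B e) = 1 - kron_edge_prob n P e"
      using p'[OF e] e by (simp add: B_def measure_pmf_single)
    also have "\<dots> \<le> exp (- kron_edge_prob n P e)"
      using exp_ge_add_one_self[of "- kron_edge_prob n P e"] by simp
    finally show "measure_pmf.prob (bernoulli_pmf (kron_edge_prob n P e)) (B e) \<le> exp (- kron_edge_prob n P e)" .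
  qed simp
  also have "\<dots> = exp (- (\<Sum>e\<in>E. kron_edge_prob n P e))"
    using finite_subset[OF E finite_vertex_pairs] by (simp add: exp_sum sum_negf[symmetric])
  also have "(\<Sum>e\<in>E. kron_edge_prob n P e) = kron_mass n P X Y"
    unfolding E_def kron_mass_def sum.reindex[OF inj]
    by (simp add: kron_edge_prob_pair[OF P(1)] sum.cartesian_product case_prod_unfold)
  finally show ?thesis .
qed

lemma sum_power_card_Pow:
  fixes t :: "'a :: comm_semiring_1"
  assumes "finite A"
  shows "(\<Sum>S\<in>Pow A. t ^ card S) = (1 + t) ^ card A"
  using prod_add[OF assms, of "\<lambda>_. t" "\<lambda>_. 1"] by (simp add: add.commute)

text \<open>Each bad pair has probability at most \<open>t ^ card S\<close>, and there are
  \<open>2 ^ card S\<close> choices of \<open>X\<close> in \<open>S\<close>. Summing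
  \<open>(2 * t) ^ card S\<close> over nonempty \<open>S\<close> gives
  \<open>(1 + 2 * t) ^ card V - 1\<close>, which is small since \<open>exp 2 > 2\<close>.\<close>

lemma prob_not_expanding_le:
  assumes P: "\<And>a b. P a b = P b a" "\<And>a b. P a b \<in> {0..1}"
    and V: "V \<subseteq> cube n"
  defines "Q \<equiv> Pi_pmf (vertex_pairs n) False (\<lambda>e. bernoulli_pmf (kron_edge_prob n P e))"
  shows "measure_pmf.prob Q {f. \<not> expanding n P V f} \<le> exp (2 ^ n * (2 * exp (- 2 * real n))) - 1"
proof -
  define t where "t = exp (- 2 * real n)"
  \<comment> \<open>The deterministic mass condition is part of the event, so \<open>A S X\<close>
    is empty for harmless pairs and the union may run over all of them.\<close>
  define A where "A = (\<lambda>S X. {f. (\<forall>x\<in>X. \<forall>y\<in>V - S. \<not> f {x, y}) \<and> 2 * real n * real (card S) < kron_mass n P X (V - S)})"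
  have finV: "finite V" using V finite_cube finite_subset by blast
  have A: "measure_pmf.prob Q (A S X) \<le> t ^ card S" if "S \<subseteq> V" "X \<subseteq> S" for S X
  proof (cases "2 * real n * real (card S) < kron_mass n P X (V - S)")
    case True
    then have "measure_pmf.prob Q (A S X) = measure_pmf.prob Q {f. \<forall>x\<in>X. \<forall>y\<in>V - S. \<not> f {x, y}}"
      by (simp add: A_def)
    also have "\<dots> \<le> exp (- kron_mass n P X (V - S))"
      unfolding Q_def using that V by (intro prob_no_edges_le P) auto
    also have "\<dots> \<le> exp (- (2 * real n * real (card S)))" using True by simp
    also have "\<dots> = t ^ card S" unfolding t_def exp_of_nat_mult[symmetric] by (simp add: mult_ac)
    finally show ?thesis .
  qed (simp add: A_def t_def)
  have "measure_pmf.prob Q {f. \<not> expanding n P V f} \<le> measure_pmf.prob Q (\<Union>S\<in>Pow V - {{}}. \<Union>X\<in>Pow S. A S X)"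
  proof (intro measure_pmf.finite_measure_mono subsetI)
    fix f assume "f \<in> {f. \<not> expanding n P V f}"
    then obtain X S where "X \<subseteq> S" "S \<subseteq> V" "X \<noteq> {}" "\<forall>x\<in>X. \<forall>y\<in>V - S. \<not> f {x, y}"
        "2 * real n * real (card S) < kron_mass n P X (V - S)"
      unfolding expanding_def mem_Collect_eq not_all not_imp not_le by blast
    then have "f \<in> A S X" "S \<in> Pow V - {{}}" "X \<in> Pow S" by (auto simp: A_def)
    then show "f \<in> (\<Union>S\<in>Pow V - {{}}. \<Union>X\<in>Pow S. A S X)" by blast
  qed simp
  also have "\<dots> \<le> (\<Sum>S\<in>Pow V - {{}}. measure_pmf.prob Q (\<Union>X\<in>Pow S. A S X))"
    using finV by (intro measure_pmf.finite_measure_subadditive_finite) auto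
  also have "\<dots> \<le> (\<Sum>S\<in>Pow V - {{}}. (2 * t) ^ card S)"
  proof (rule sum_mono)
    fix S assume S: "S \<in> Pow V - {{}}"
    then have finS: "finite S" using finV finite_subset by blast
    have "measure_pmf.prob Q (\<Union>X\<in>Pow S. A S X) \<le> (\<Sum>X\<in>Pow S. measure_pmf.prob Q (A S X))"
      using finS by (intro measure_pmf.finite_measure_subadditive_finite) auto
    also have "\<dots> \<le> (\<Sum>X\<in>Pow S. t ^ card S)" using S by (intro sum_mono A) auto
    also have "\<dots> = (2 * t) ^ card S" using finS by (simp add: card_Pow power_mult_distrib)
    finally show "measure_pmf.prob Q (\<Union>X\<in>Pow S. A S X) \<le> (2 * t) ^ card S" .
  qed
  also have "\<dots> = (1 + 2 * t) ^ card V - 1"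
    unfolding sum_power_card_Pow[OF finV, symmetric] using finV by (simp add: sum_diff1)
  also have "(1 + 2 * t) ^ card V \<le> (1 + 2 * t) ^ (2 ^ n)"
    using card_mono[OF finite_cube V] by (intro power_increasing) (auto simp: card_cube t_def)
  also have "\<dots> \<le> exp (2 * t) ^ (2 ^ n)" by (intro power_mono) (auto simp: t_def)
  also have "\<dots> = exp (2 ^ n * (2 * t))" unfolding exp_of_nat_mult[symmetric] by simp
  finally show ?thesis by (simp add: t_def)
qed

subsection \<open>Growth of neighbourhoods\<close>

text \<open>Closed neighbourhood, so that its \<open>k\<close>-fold iterate on a vertex is the ball
  of radius \<open>k\<close> in the graph that \<open>f\<close> induces on \<open>V\<close>.\<close>

definition nbhd :: "bool list set \<Rightarrow> (bool list set \<Rightarrow> bool) \<Rightarrow> bool list set \<Rightarrow> bool list set" where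
  "nbhd V f X = X \<union> {y \<in> V. \<exists>x\<in>X. x \<noteq> y \<and> f {x, y}}"

lemma nbhd_subset: "X \<subseteq> V \<Longrightarrow> nbhd V f X \<subseteq> V"
  by (auto simp: nbhd_def)

lemma expanding_nbhd:
  assumes "expanding n P V f" "X \<subseteq> V" "X \<noteq> {}"
  shows "kron_mass n P X (V - nbhd V f X) \<le> 2 * real n * real (card (nbhd V f X))"
proof -
  have "\<not> f {x, y}" if "x \<in> X" "y \<in> V - nbhd V f X" for x y
    using that by (auto simp: nbhd_def)
  moreover have "X \<subseteq> nbhd V f X" by (auto simp: nbhd_def)
  ultimately show ?thesis
    using assms(1,3) nbhd_subset[OF assms(2), of f] unfolding expanding_def by blast
qed

lemma walk_of_iterated_nbhd:
  assumes "y \<in> (nbhd V f ^^ k) {u}" "u \<in> V"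
    and G: "\<And>x y. x \<in> V \<Longrightarrow> y \<in> V \<Longrightarrow> x \<noteq> y \<Longrightarrow> f {x, y} \<Longrightarrow> {x, y} \<in> snd G" "fst G = V"
  shows "\<exists>xs. is_walk G u xs y \<and> length xs \<le> k + 1"
  using assms(1)
proof (induction k arbitrary: y)
  case 0
  then show ?case using assms(2) G(2) by (intro exI[of _ "[u]"]) (auto simp: is_walk_def)
next
  case (Suc k)
  have sub: "(nbhd V f ^^ k) {u} \<subseteq> V"
    using assms(2) by (induction k) (simp_all add: nbhd_subset)
  have "y \<in> nbhd V f ((nbhd V f ^^ k) {u})" using Suc.prems by simp
  then consider "y \<in> (nbhd V f ^^ k) {u}"
    | x where "x \<in> (nbhd V f ^^ k) {u}" "y \<in> V" "x \<noteq> y" "f {x, y}"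
    unfolding nbhd_def[of V f "(nbhd V f ^^ k) {u}"] by blast
  then show ?case
  proof cases
    case 1
    then obtain xs where "is_walk G u xs y" "length xs \<le> k + 1" using Suc.IH by blast
    then show ?thesis by (intro exI[of _ xs]) simp
  next
    case 2
    obtain xs where xs: "is_walk G u xs x" "length xs \<le> k + 1" using Suc.IH[OF 2(1)] by blast
    have "{x, y} \<in> snd G" using 2 sub by (intro G(1)) auto
    then have "is_walk G u (xs @ [y]) y"
      using xs(1) 2(2) G(2) by (simp add: is_walk_def successively_append_iff)
    then show ?thesis using xs(2) by (intro exI[of _ "xs @ [y]"]) simp
  qed
qed

lemma graph_dist_le_of_walks:
  assumes "is_walk G u xs w" "length xs \<le> k + 1" "is_walk G v ys w" "length ys \<le> l + 1"
  shows "graph_dist G u v \<le> enat (k + l)"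
proof -
  have ys: "ys \<noteq> []" "hd ys = v" "last ys = w" "set ys \<subseteq> fst G" "successively (\<lambda>x y. {x, y} \<in> snd G) ys"
    using assms(3) by (auto simp: is_walk_def)
  \<comment> \<open>Dropping the head of \<open>rev ys\<close> avoids repeating \<open>w\<close>;
    this leaves at most \<open>k + l + 1\<close> vertices, hence \<open>k + l\<close> edges.\<close>
  define zs where "zs = xs @ tl (rev ys)"
  have ry: "rev ys = w # tl (rev ys)"
    using ys(1,3) by (cases ys rule: rev_cases) auto
  have "successively (\<lambda>x y. {x, y} \<in> snd G) (w # tl (rev ys))"
    unfolding ry[symmetric] using ys(5) by (simp add: insert_commute)
  moreover have "last (w # tl (rev ys)) = v"
    unfolding ry[symmetric] using ys by (simp add: last_rev)
  moreover have "set (w # tl (rev ys)) \<subseteq> fst G"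
    unfolding ry[symmetric] using ys by simp
  moreover have "xs \<noteq> []" "hd xs = u" "last xs = w" "set xs \<subseteq> fst G" "successively (\<lambda>x y. {x, y} \<in> snd G) xs"
    using assms(1) by (auto simp: is_walk_def)
  ultimately have "is_walk G u zs v"
    unfolding is_walk_def zs_def successively_append_iff
    by (cases "tl (rev ys)") simp_all
  moreover have "length zs - 1 \<le> k + l"
    using assms(2,4) by (simp add: zs_def)
  ultimately show ?thesis
    unfolding graph_dist_def by (intro INF_lower2[of zs]) simp_all
qed

lemma kron_mass_mono:
  assumes "\<And>a b. 0 \<le> P a b" "finite Y'" "Y \<subseteq> Y'"
  shows "kron_mass n P X Y \<le> kron_mass n P X Y'"
  unfolding kron_mass_def kron_prob_def
  using assms by (intro sum_mono sum_mono2) (auto intro!: prod_nonneg)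

lemma kron_matrix_nonneg: "0 \<le> \<beta> \<Longrightarrow> 0 \<le> \<gamma> \<Longrightarrow> 0 \<le> kron_matrix \<gamma> \<beta> \<gamma> a b"
  by (cases a; cases b) auto

lemma middle_layer_subset_cube: "middle_layer n \<subseteq> cube n"
  by (auto simp: middle_layer_def)

text \<open>The mass leaving \<open>X\<close> either stays within its neighbourhood, where the upper
  hypercontractive bound caps it, or is bounded by expansion; both cases force growth.\<close>
lemma card_nbhd_ge:
  fixes \<beta> \<gamma> r \<eta> \<omega> :: real
  assumes r: "0 \<le> r" "r < 1" and bg: "\<bar>\<beta> - \<gamma>\<bar> \<le> r * (\<beta> + \<gamma>)" and nn: "0 \<le> \<beta>" "0 \<le> \<gamma>"
    and B: "1 < \<beta> + \<gamma>" and n: "even n" "0 < n"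
    and c1: "4 * real n * (real n + 1) * exp (\<omega> * n) \<le> (\<beta> + \<gamma>) ^ n"
    and c2: "4 * (real n + 1)\<^sup>2 * exp (\<omega> * n) \<le> exp (\<eta> * (1 - r) * n)"
    and f: "expanding n (kron_matrix \<gamma> \<beta> \<gamma>) (middle_layer n) f"
    and X: "X \<subseteq> middle_layer n" "X \<noteq> {}" "card X \<le> 2 ^ n * exp (- \<eta> * n)"
  shows "exp (\<omega> * n) * card X \<le> card (nbhd (middle_layer n) f X)"
proof -
  let ?V = "middle_layer n" and ?P = "kron_matrix \<gamma> \<beta> \<gamma>" and ?s = "1 / (1 + r)"
  define S where "S = nbhd ?V f X"
  define d where "d = card X / 2 ^ n"
  define d' where "d' = card S / 2 ^ n"
  have S: "S \<subseteq> ?V" using nbhd_subset[OF X(1)] by (simp add: S_def)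
  have finV: "finite ?V" using middle_layer_subset_cube finite_cube finite_subset by blast
  have "finite X" using X(1) finV finite_subset by blast
  then have X0: "card X > 0" using X(2) by (simp add: card_gt_0_iff)
  then have d: "d > 0" "d' \<ge> 0" by (simp_all add: d_def d'_def)
  have "(\<beta> + \<gamma>) ^ n / (n + 1) * card X \<le> kron_mass n ?P X ?V"
    unfolding kron_mass_def mult.commute[of _ "real (card X)"]
    by (rule sum_bounded_below) (use X(1) middle_layer_mass_ge[OF n(1)] in blast)
  also have "\<dots> = kron_mass n ?P X S + kron_mass n ?P X (?V - S)"
    unfolding kron_mass_def sum.distrib[symmetric]
    by (intro sum.cong refl sum.subset_diff[OF S finV, THEN trans] add.commute)
  also have "kron_mass n ?P X (?V - S) \<le> 2 * real n * real (card S)"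
    unfolding S_def by (rule expanding_nbhd[OF f X(1,2)])
  finally have split: "(\<beta> + \<gamma>) ^ n / (n + 1) * card X \<le> kron_mass n ?P X S + 2 * real n * real (card S)"
    by simp
  show ?thesis
  \<comment> \<open>Either the expansion bound carries at least half of the mass, or more than half
    stays inside \<open>S\<close>.\<close>
  proof (cases "(\<beta> + \<gamma>) ^ n / (n + 1) * card X \<le> 4 * real n * real (card S)")
    case True
    have "(4 * real n * (real n + 1)) * (exp (\<omega> * n) * card X) \<le> (\<beta> + \<gamma>) ^ n * card X"
      using mult_right_mono[OF c1, of "real (card X)"] by (simp add: mult_ac)
    also have "\<dots> \<le> (4 * real n * (real n + 1)) * card S"
      using True by (simp add: divide_le_eq algebra_simps)
    finally show ?thesis using n by (simp add: S_def)
  next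
    case False
    have "(\<beta> + \<gamma>) ^ n * (2 ^ n * d) / (n + 1) < 2 * kron_mass n ?P X S"
      using False split by (simp add: d_def)
    also have "\<dots> \<le> 2 * ((2 * (\<beta> + \<gamma>)) ^ n * (d powr ?s * d' powr ?s))"
      unfolding d_def d'_def
      using kron_mass_upper[OF r bg nn, of X n S] X(1) S middle_layer_subset_cube by fastforce
    also have "(2 * (\<beta> + \<gamma>)) ^ n = (\<beta> + \<gamma>) ^ n * 2 ^ n"
      by (simp only: power_mult_distrib mult.commute)
    finally have "((\<beta> + \<gamma>) ^ n * 2 ^ n) * d < ((\<beta> + \<gamma>) ^ n * 2 ^ n) * (2 * (real n + 1) * (d powr ?s * d' powr ?s))"
      by (simp add: divide_less_eq algebra_simps)
    then have "d \<le> 2 * (real n + 1) * (d powr ?s * d' powr ?s)"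
      using B by (simp add: mult_less_cancel_left)
    \<comment> \<open>Raising to the power \<open>1 + r\<close> removes the exponent
      \<open>?s\<close>; one factor \<open>d\<close> then cancels and leaves the gain
      \<open>d powr (r - 1)\<close>.\<close>
    then have "d powr (1 + r) \<le> (2 * (real n + 1) * (d powr ?s * d' powr ?s)) powr (1 + r)"
      using d r by (intro powr_mono2) auto
    also have "\<dots> = (2 * (real n + 1)) powr (1 + r) * (d * d')"
      using d r by (simp only: powr_mult powr_powr) simp
    also have "\<dots> \<le> (2 * (real n + 1)) powr 2 * (d * d')"
      using d r by (intro mult_right_mono powr_mono) auto
    also have "(2 * (real n + 1)) powr 2 = 4 * (real n + 1)\<^sup>2"
      by (simp add: power2_eq_square algebra_simps)
    also have "d powr (1 + r) = d * (d * d powr (r - 1))"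
      using d by (simp add: powr_add powr_diff)
    finally have "d * (d * d powr (r - 1)) \<le> d * (4 * (real n + 1)\<^sup>2 * d')"
      by (simp only: mult_ac)
    then have 1: "d * d powr (r - 1) \<le> 4 * (real n + 1)\<^sup>2 * d'"
      using d by simp
    \<comment> \<open>Sparsity of \<open>X\<close> makes the gain exponentially large, which pays
      for both the polynomial factor and \<open>exp (\<omega> * n)\<close>.\<close>
    have "d \<le> exp (- \<eta> * n)" using X(3) by (simp add: d_def divide_le_eq mult.commute)
    then have "ln d \<le> - \<eta> * n" using d by (metis exp_le_cancel_iff exp_ln)
    then have "(1 - r) * (\<eta> * n) \<le> (1 - r) * - ln d" using r by (intro mult_left_mono) auto
    then have "exp (\<eta> * (1 - r) * n) \<le> d powr (r - 1)"
      using d by (simp add: powr_def algebra_simps)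
    with c2 have "4 * (real n + 1)\<^sup>2 * exp (\<omega> * n) \<le> d powr (r - 1)" by linarith
    then have "d * (4 * (real n + 1)\<^sup>2 * exp (\<omega> * n)) \<le> 4 * (real n + 1)\<^sup>2 * d'"
      using 1 d by (meson mult_left_mono less_imp_le order_trans)
    then have "4 * (real n + 1)\<^sup>2 * (exp (\<omega> * n) * d) \<le> 4 * (real n + 1)\<^sup>2 * d'"
      by (simp only: mult_ac)
    then have "exp (\<omega> * n) * d \<le> d'"
      by (rule mult_left_le_imp_le) (simp add: add_nonneg_pos)
    then show ?thesis by (simp add: d_def d'_def S_def divide_le_cancel)
  qed
qed

text \<open>If \<open>Y\<close> missed the closed neighbourhood of \<open>X\<close>, expansion would
  cap the mass between them by \<open>2 * n * 2 ^ n\<close>, while reverse hypercontractivity gives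
  at least \<open>(2 * (\<beta> + \<gamma>)) ^ n * exp (- 2 * \<eta> / (1 - r) * n)\<close>.\<close>

lemma nbhd_meets:
  fixes \<beta> \<gamma> r \<eta> :: real
  assumes r: "0 \<le> r" "r < 1" and bg: "\<bar>\<beta> - \<gamma>\<bar> \<le> r * (\<beta> + \<gamma>)" and nn: "0 \<le> \<beta>" "0 \<le> \<gamma>"
    and B: "1 < \<beta> + \<gamma>"
    and c3: "2 * real n * exp (2 * (\<eta> / (1 - r)) * n) < (\<beta> + \<gamma>) ^ n"
    and f: "expanding n (kron_matrix \<gamma> \<beta> \<gamma>) (middle_layer n) f"
    and X: "X \<subseteq> middle_layer n" "2 ^ n * exp (- \<eta> * n) \<le> card X"
    and Y: "Y \<subseteq> middle_layer n" "2 ^ n * exp (- \<eta> * n) \<le> card Y"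
  shows "nbhd (middle_layer n) f X \<inter> Y \<noteq> {}"
proof
  assume disj: "nbhd (middle_layer n) f X \<inter> Y = {}"
  let ?V = "middle_layer n" and ?P = "kron_matrix \<gamma> \<beta> \<gamma>" and ?s = "1 / (1 - r)"
  let ?S = "nbhd (middle_layer n) f X" and ?h = "\<eta> / (1 - r) * n"
  have finV: "finite ?V" using middle_layer_subset_cube finite_cube finite_subset by blast
  have "0 < 2 ^ n * exp (- \<eta> * n)" by simp
  then have "card X \<noteq> 0" using X(2) by linarith
  then have X0: "X \<noteq> {}" by auto
  have pw: "exp (- ?h) \<le> (real (card Z) / 2 ^ n) powr ?s" if "2 ^ n * exp (- \<eta> * n) \<le> card Z" for Z :: "bool list set"
  proof -
    have "exp (- \<eta> * n) \<le> real (card Z) / 2 ^ n" using that by (simp add: le_divide_eq mult.commute)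
    then have "exp (- \<eta> * n) powr ?s \<le> (real (card Z) / 2 ^ n) powr ?s"
      using r by (intro powr_mono2) auto
    then show ?thesis by (simp add: powr_def)
  qed
  have "(2 * (\<beta> + \<gamma>)) ^ n * (exp (- ?h) * exp (- ?h))
      \<le> (2 * (\<beta> + \<gamma>)) ^ n * ((real (card X) / 2 ^ n) powr ?s * (real (card Y) / 2 ^ n) powr ?s)"
    using B by (intro mult_left_mono mult_mono pw X Y) auto
  also have "\<dots> \<le> kron_mass n ?P X Y"
    using X(1) Y(1) middle_layer_subset_cube by (intro kron_mass_lower[OF r bg nn]) blast+
  also have "\<dots> \<le> kron_mass n ?P X (?V - ?S)"
    using disj Y(1) finV nn by (intro kron_mass_mono kron_matrix_nonneg) auto
  also have "\<dots> \<le> 2 * real n * real (card ?S)"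
    by (rule expanding_nbhd[OF f X(1) X0])
  also have "\<dots> \<le> 2 * real n * 2 ^ n"
  proof -
    have "card ?S \<le> 2 ^ n"
      using card_mono[OF finite_cube, of ?S n] nbhd_subset[OF X(1)] middle_layer_subset_cube
      by (force simp: card_cube)
    then have "real (card ?S) \<le> 2 ^ n" using of_nat_mono by fastforce
    then show ?thesis by (intro mult_left_mono) auto
  qed
  finally have "(2 * (\<beta> + \<gamma>)) ^ n * (exp (- ?h) * exp (- ?h)) \<le> 2 * real n * 2 ^ n" .
  moreover have "exp (- ?h) * exp (- ?h) = exp (- (2 * ?h))"
    by (simp only: exp_add[symmetric]) simp
  ultimately have "2 ^ n * ((\<beta> + \<gamma>) ^ n * exp (- (2 * ?h))) \<le> 2 ^ n * (2 * real n)"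
    by (simp only: power_mult_distrib mult_ac)
  then have "(\<beta> + \<gamma>) ^ n * exp (- (2 * ?h)) \<le> 2 * real n" by simp
  then have "(\<beta> + \<gamma>) ^ n \<le> 2 * real n * exp (2 * ?h)"
    by (simp add: exp_minus field_simps)
  with c3 show False by (simp add: mult.assoc)
qed

section \<open>Bounded diameter from expansion\<close>

text \<open>Balls grow by a factor \<open>exp (\<omega> * n)\<close> per step until their density
  reaches \<open>exp (- \<eta> * n)\<close>, which takes at most \<open>k\<close> steps. Two balls
  of radius \<open>k\<close> then meet after one further step of one of them, whence
  \<open>2 * k + 1\<close>.\<close>

lemma diam_middle_layer_le:
  fixes \<beta> \<gamma> r \<eta> \<omega> :: real
  assumes r: "0 \<le> r" "r < 1" and bg: "\<bar>\<beta> - \<gamma>\<bar> \<le> r * (\<beta> + \<gamma>)" and nn: "0 \<le> \<beta>" "0 \<le> \<gamma>"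
    and B: "1 < \<beta> + \<gamma>" and n: "even n" "0 < n" and \<omega>: "0 < \<omega>" and \<eta>: "0 < \<eta>"
    and c1: "4 * real n * (real n + 1) * exp (\<omega> * n) \<le> (\<beta> + \<gamma>) ^ n"
    and c2: "4 * (real n + 1)\<^sup>2 * exp (\<omega> * n) \<le> exp (\<eta> * (1 - r) * n)"
    and c3: "2 * real n * exp (2 * (\<eta> / (1 - r)) * n) < (\<beta> + \<gamma>) ^ n"
    and f: "expanding n (kron_matrix \<gamma> \<beta> \<gamma>) (middle_layer n) f"
    and k: "ln 2 \<le> k * \<omega>"
  shows "diam (induced_subgraph (cube n, {e \<in> vertex_pairs n. f e}) (middle_layer n)) \<le> enat (2 * k + 1)"
proof -
  let ?V = "middle_layer n"
  define H where "H = induced_subgraph (cube n, {e \<in> vertex_pairs n. f e}) ?V"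
  have H1: "fst H = ?V"
    using middle_layer_subset_cube by (auto simp: H_def induced_subgraph_def)
  have H2: "{x, y} \<in> snd H" if "x \<in> ?V" "y \<in> ?V" "x \<noteq> y" "f {x, y}" for x y
    using that middle_layer_subset_cube by (auto simp: H_def induced_subgraph_def vertex_pairs_def)
  have finV: "finite ?V" using middle_layer_subset_cube finite_cube finite_subset by blast
  define N where "N = (\<lambda>i u. (nbhd ?V f ^^ i) {u})"
  have N: "N i u \<subseteq> ?V \<and> N i u \<noteq> {}" if "u \<in> ?V" for i u
  proof (induction i)
    case (Suc i)
    have "N (Suc i) u = nbhd ?V f (N i u)" by (simp add: N_def)
    then show ?case using Suc nbhd_subset[of "N i u" ?V f] by (auto simp: nbhd_def)
  qed (use that in \<open>simp add: N_def\<close>)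
  \<comment> \<open>The minimum records saturation: beyond the density threshold
    \<open>card_nbhd_ge\<close> gives no growth, but closed neighbourhoods do not shrink.\<close>
  have grow: "min (exp (i * (\<omega> * n))) (2 ^ n * exp (- \<eta> * n)) \<le> card (N i u)" if u: "u \<in> ?V" for i u
  proof (induction i)
    case 0
    show ?case by (simp add: N_def)
  next
    case (Suc i)
    have NS: "N (Suc i) u = nbhd ?V f (N i u)" by (simp add: N_def)
    have mono: "card (N i u) \<le> card (N (Suc i) u)"
      using N[OF u, of "Suc i"] finV finite_subset unfolding NS
      by (intro card_mono) (auto simp: nbhd_def)
    show ?case
    proof (cases "card (N i u) \<le> 2 ^ n * exp (- \<eta> * n)")
      case True
      have step: "exp (\<omega> * n) * card (N i u) \<le> card (N (Suc i) u)"
        unfolding NS using N[OF u] True by (intro card_nbhd_ge[OF r bg nn B n c1 c2 f]) auto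
      have ex: "exp (Suc i * (\<omega> * n)) = exp (\<omega> * n) * exp (i * (\<omega> * n))"
        by (simp add: exp_add[symmetric] algebra_simps)
      show ?thesis
      proof (cases "exp (i * (\<omega> * n)) \<le> card (N i u)")
        case True
        then have "exp (\<omega> * n) * exp (i * (\<omega> * n)) \<le> exp (\<omega> * n) * card (N i u)" by simp
        then show ?thesis using step ex by linarith
      next
        case False
        then show ?thesis using Suc.IH mono by linarith
      qed
    next
      case False
      then show ?thesis using mono by linarith
    qed
  qed
  have large: "2 ^ n * exp (- \<eta> * n) \<le> card (N k u)" if u: "u \<in> ?V" for u
  proof -
    \<comment> \<open>By \<open>ln 2 \<le> k * \<omega>\<close>, growth up to step \<open>k\<close>
      would exceed the whole cube, so the minimum is attained by the threshold.\<close>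
    have "(2 :: real) ^ n = exp (ln 2 * n)" by (simp add: exp_of_nat2_mult)
    also have "\<dots> \<le> exp (k * (\<omega> * n))"
      using mult_right_mono[OF k, of "real n"] by (simp add: mult.assoc)
    finally have "(2 :: real) ^ n \<le> exp (k * (\<omega> * n))" .
    moreover have "2 ^ n * exp (- \<eta> * n) \<le> (2 :: real) ^ n" using \<eta> by simp
    ultimately show ?thesis using grow[OF u, of k] by linarith
  qed
  have "graph_dist H u v \<le> enat (2 * k + 1)" if uv: "u \<in> ?V" "v \<in> ?V" for u v
  proof -
    have "nbhd ?V f (N k u) \<inter> N k v \<noteq> {}"
      using N uv large by (intro nbhd_meets[OF r bg nn B c3 f]) auto
    then obtain w where w: "w \<in> (nbhd ?V f ^^ Suc k) {u}" "w \<in> (nbhd ?V f ^^ k) {v}"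
      by (auto simp: N_def)
    obtain xs where xs: "is_walk H u xs w" "length xs \<le> Suc k + 1"
      using walk_of_iterated_nbhd[OF w(1) uv(1) H2 H1] by blast
    obtain ys where ys: "is_walk H v ys w" "length ys \<le> k + 1"
      using walk_of_iterated_nbhd[OF w(2) uv(2) H2 H1] by blast
    show ?thesis using graph_dist_le_of_walks[OF xs ys] by (simp add: mult_2)
  qed
  then show ?thesis unfolding diam_def H_def[symmetric] H1 by (intro SUP_least)
qed

section \<open>Choice of constants and the limit\<close>

lemma eventually_square_less_exp:
  fixes w :: real
  assumes "0 < w"
  shows "\<forall>\<^sub>F n in sequentially. 4 * (real n + 1)\<^sup>2 < exp (w * n)"
  using assms by real_asymp

theorem theorem3:
  fixes \<alpha> \<beta> \<gamma> :: real
  assumes "\<alpha> \<in> {0..1}" "\<beta> \<in> {0..1}" "\<gamma> \<in> {0..1}"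
    and "\<alpha> = \<gamma>" and "\<beta> + \<gamma> > 1"
  shows "\<exists>c::nat.
    ((\<lambda>n. measure_pmf.prob (kronecker_graph n (kron_matrix \<alpha> \<beta> \<gamma>))
            {G. diam (induced_subgraph G (middle_layer n)) < enat c}) \<longlongrightarrow> 1)
      (inf at_top (principal {n. even n}))"
proof -
  define B where "B = \<beta> + \<gamma>"
  define r where "r = \<bar>\<beta> - \<gamma>\<bar> / B"
  \<comment> \<open>Chosen so that \<open>\<eta> / (1 - r) = ln B / 4\<close>: the density loss for
    two large sets uses half of the exponent \<open>ln B\<close>.\<close>
  define \<eta> where "\<eta> = (1 - r) * ln B / 4"
  \<comment> \<open>Half of the available growth exponent \<open>\<eta> * (1 - r)\<close>; the other
    half absorbs polynomial factors.\<close>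
  define \<omega> where "\<omega> = (1 - r) * \<eta> / 2"
  define k where "k = nat \<lceil>ln 2 / \<omega>\<rceil>"
  let ?P = "kron_matrix \<gamma> \<beta> \<gamma>" and ?F = "inf sequentially (principal {n. even n})"
  define Q where "Q = (\<lambda>n. Pi_pmf (vertex_pairs n) False (\<lambda>e. bernoulli_pmf (kron_edge_prob n ?P e)))"
  have nn: "0 \<le> \<beta>" "0 \<le> \<gamma>" and B: "1 < \<beta> + \<gamma>" "B > 1" using assms by (auto simp: B_def)
  \<comment> \<open>Both parameters are at most 1 and sum to more than 1, so both are positive; this
    is what makes \<open>r < 1\<close>.\<close>
  have "\<bar>\<beta> - \<gamma>\<bar> < B" using assms by (auto simp: B_def abs_if)
  then have r: "0 \<le> r" "r < 1" and bg: "\<bar>\<beta> - \<gamma>\<bar> \<le> r * (\<beta> + \<gamma>)"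
    using B by (simp_all add: r_def flip: B_def)
  have lnB: "0 < ln B" using B by simp
  have \<eta>: "0 < \<eta>" "\<eta> \<le> ln B / 4" using r lnB by (simp_all add: \<eta>_def mult_left_le_one_le)
  have \<omega>: "0 < \<omega>" "\<omega> \<le> \<eta> / 2" using r \<eta> by (simp_all add: \<omega>_def mult_left_le_one_le)
  have k: "ln 2 \<le> k * \<omega>"
  proof -
    have "ln 2 / \<omega> \<le> k" unfolding k_def using \<omega> by (simp add: of_nat_ceiling)
    then show ?thesis using \<omega> by (simp add: divide_le_eq)
  qed
  have diam: "diam (induced_subgraph (cube n, {e \<in> vertex_pairs n. f e}) (middle_layer n)) < enat (2 * k + 2)"
    if n: "even n" "0 < n" and large: "4 * (real n + 1)\<^sup>2 < exp (\<omega> * n)"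
      and f: "expanding n ?P (middle_layer n) f" for n f
  proof -
    have Bn: "(\<beta> + \<gamma>) ^ n = exp (ln B * n)"
      using B by (simp add: B_def exp_of_nat2_mult)
    \<comment> \<open>A spare exponent \<open>\<omega>\<close> swallows the polynomial; all three
      numerical conditions follow from this.\<close>
    have absorb: "4 * (real n + 1)\<^sup>2 * exp (x * n) < exp (y * n)" if "x + \<omega> \<le> y" for x y
    proof -
      have "4 * (real n + 1)\<^sup>2 * exp (x * n) < exp (\<omega> * n) * exp (x * n)" using large by simp
      also have "\<dots> = exp ((x + \<omega>) * n)" by (simp add: exp_add[symmetric] algebra_simps)
      also have "\<dots> \<le> exp (y * n)" using that by (simp add: mult_right_mono)
      finally show ?thesis .
    qed
    have "diam (induced_subgraph (cube n, {e \<in> vertex_pairs n. f e}) (middle_layer n)) \<le> enat (2 * k + 1)"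
    proof (rule diam_middle_layer_le[OF r bg nn B(1) n \<omega>(1) \<eta>(1) _ _ _ f k])
      have "4 * real n * (real n + 1) \<le> 4 * (real n + 1)\<^sup>2"
        by (simp add: power2_eq_square algebra_simps)
      then have "4 * real n * (real n + 1) * exp (\<omega> * n) \<le> 4 * (real n + 1)\<^sup>2 * exp (\<omega> * n)"
        by (rule mult_right_mono) simp
      also have "\<dots> \<le> exp (ln B * n)" using absorb[of \<omega> "ln B"] \<omega> \<eta> by simp
      finally show "4 * real n * (real n + 1) * exp (\<omega> * n) \<le> (\<beta> + \<gamma>) ^ n" unfolding Bn .
      show "4 * (real n + 1)\<^sup>2 * exp (\<omega> * n) \<le> exp (\<eta> * (1 - r) * n)"
        using absorb[of \<omega> "\<eta> * (1 - r)"] by (simp add: \<omega>_def mult.commute)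
      have "\<eta> / (1 - r) = ln B / 4" using r by (simp add: \<eta>_def divide_eq_eq)
      then have e: "2 * (\<eta> / (1 - r)) = ln B / 2" by (simp only:)
      have "4 * (real n + 1)\<^sup>2 * exp (2 * (\<eta> / (1 - r)) * n) < exp (ln B * n)"
        unfolding e using absorb[of "ln B / 2" "ln B"] \<omega> \<eta> by simp
      moreover have "2 * real n \<le> 4 * (real n + 1)\<^sup>2"
        by (simp add: power2_eq_square algebra_simps)
      then have "2 * real n * exp (2 * (\<eta> / (1 - r)) * n) \<le> 4 * (real n + 1)\<^sup>2 * exp (2 * (\<eta> / (1 - r)) * n)"
        by (rule mult_right_mono) simp
      ultimately show "2 * real n * exp (2 * (\<eta> / (1 - r)) * n) < (\<beta> + \<gamma>) ^ n"
        unfolding Bn by linarith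
    qed
    also have "\<dots> < enat (2 * k + 2)" by simp
    finally show ?thesis .
  qed
  let ?p = "\<lambda>n. measure_pmf.prob (kronecker_graph n ?P) {G. diam (induced_subgraph G (middle_layer n)) < enat (2 * k + 2)}"
  \<comment> \<open>One minus the bound \<open>exp (...) - 1\<close> on the probability that
    expansion fails.\<close>
  let ?q = "\<lambda>n. 2 - exp (2 ^ n * (2 * exp (- 2 * real n)))"
  have "?q n \<le> ?p n" if n: "even n" "0 < n" "4 * (real n + 1)\<^sup>2 < exp (\<omega> * n)" for n
  proof -
    have P01: "?P a b \<in> {0..1}" for a b using assms by (cases a; cases b) auto
    have "?q n \<le> 1 - measure_pmf.prob (Q n) {f. \<not> expanding n ?P (middle_layer n) f}"
      using prob_not_expanding_le[where P = ?P, OF kron_matrix_sym P01 middle_layer_subset_cube, of n] by (simp add: Q_def)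
    also have "\<dots> = measure_pmf.prob (Q n) {f. expanding n ?P (middle_layer n) f}"
      by (subst measure_pmf.prob_compl[symmetric]) (auto intro!: arg_cong[where f = "measure_pmf.prob (Q n)"])
    also have "\<dots> \<le> measure_pmf.prob (Q n)
        {f. diam (induced_subgraph (cube n, {e \<in> vertex_pairs n. f e}) (middle_layer n)) < enat (2 * k + 2)}"
      using diam[OF n] by (intro measure_pmf.finite_measure_mono) auto
    also have "\<dots> = ?p n"
      by (simp add: kronecker_graph_def Q_def vimage_def)
    finally show ?thesis .
  qed
  then have lower: "\<forall>\<^sub>F n in ?F. ?q n \<le> ?p n"
    unfolding eventually_inf_principal
    using eventually_conj[OF eventually_square_less_exp[OF \<omega>(1)] eventually_gt_at_top[of 0]]
    by (auto elim!: eventually_mono)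
  \<comment> \<open>The exponent tends to 0 because \<open>exp 2 > 2\<close>. This holds along all
    \<open>n\<close>; evenness matters only for the comparison with \<open>?p\<close>.\<close>
  have "(?q \<longlongrightarrow> 1) sequentially" by real_asymp
  then have "(?q \<longlongrightarrow> 1) ?F" by (rule tendsto_mono[OF inf_le1])
  moreover have "\<forall>\<^sub>F n in ?F. ?p n \<le> 1" by (intro always_eventually allI measure_pmf.prob_le_1)
  ultimately have "(?p \<longlongrightarrow> 1) ?F" by (intro tendsto_sandwich[OF lower _ _ tendsto_const])
  then show ?thesis using assms(4) by blast
qed

end
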